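(* Let $d\ge 2$, let $\mathbf X=(X_1,\dots,X_d)$ be a vector of continuous real random variables and let $Y$ be a discrete random variable with values in a finite set $\mathcal Y$, where $p(y_k)=P(Y=y_k)>0$ for every $y_k\in\mathcal Y$. No restriction is made on the marginals or on the copulas beyond the existence of the (conditional) densities and the finiteness of the entropies involved. Let $(V,\mathcal C,\mathcal S,\mathcal M)$ be a GNB junction tree on $V=\{0,1,\dots,d\}$ (vertex $0$ stands for $Y$), with clusters written as $(i,\mu(i),0)$. Then the weight of the corresponding GNB probability distribution is $$W_{GNB}=\sum_{i=1}^{d}H(X_i)-\sum_{y_k\in\mathcal Y}p(y_k)\sum_{i=1}^{d}H(X_i\mid y_k)+\sum_{(i,\mu(i),0)\in\mathcal C}\ \sum_{y_k\in\mathcal Y}p(y_k)\,I_{c_{X_i,X_{\mu(i)}\mid y_k}}(U_i,U_{\mu(i)}).$$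
   Context: GNB structure: on $V=\{0\}\cup D$, $D=\{1,\dots,d\}$, a GNB graph is built as follows. Start with a triangle $\{0,i_1,i_2\}$, $i_1,i_2\in D$ distinct, and put $\mu(i_2)=i_1$. Then repeatedly add a new vertex $i_{k+1}\in D$, connecting it to $0$ and to one already present vertex $\mu(i_{k+1})\in\{i_1,\dots,i_k\}$ (its mother), until all of $D$ is used. GNB junction tree: the set of clusters $\mathcal C$ consists of the 3-element maximal cliques, i.e. the triples $\{0,i,\mu(i)\}$ for $i\in\{i_2,\dots,i_d\}$; the set of separators $\mathcal S$ consists of the pairs $S=\{0,s\}$ contained in at least two clusters; $\mathcal M$ records the multiplicities, where the multiplicity $\nu_S$ is the number of clusters containing $S$. Entropies: $H$ denotes (differential) entropy, e.g. $H(X)=-\int p(x)\log p(x)\,dx$, $H(Y)=-\sum_y p(y)\log p(y)$, and for a mixed vector $H(\mathbf X_A,Y)=-\sum_{y}\int p(\mathbf x_A,y)\log p(\mathbf x_A,y)\,d\mathbf x_A$, where $p(\mathbf x_A,y)=p(y)p(\mathbf x_A\mid y)$. $H(\cdot\mid y_k)$ denotes the entropy of the conditional distribution given $Y=y_k$. All entropies are assumed to exist and be finite. Information content: the information content of a random vector is the sum of the entropies of its components minus its joint entropy, e.g. $I(X_l,X_m,Y)=H(X_l)+H(X_m)+H(Y)-H(X_l,X_m,Y)$ and $I(X_l,Y)=H(X_l)+H(Y)-H(X_l,Y)$. Weight: $W_{GNB}=\sum_{C\in\mathcal C}I(\mathbf X_C)-\sum_{S\in\mathcal S}(\nu_S-1)I(\mathbf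 X_S)$, where $\mathbf X_C$, $\mathbf X_S$ are the vectors of the variables indexed by $C$, $S$ (index $0$ being $Y$). Copula information: $c_{X_i,X_j\mid y_k}$ is the copula density of the conditional distribution of $(X_i,X_j)$ given $Y=y_k$, i.e. the density of $(U_i,U_j)=(F_{i\mid y_k}(X_i),F_{j\mid y_k}(X_j))$ conditionally on $Y=y_k$, where $F_{i\mid y_k}$ is the conditional c.d.f. of $X_i$ given $Y=y_k$. $I_{c_{X_i,X_j\mid y_k}}(U_i,U_j)$ is the information content of $(U_i,U_j)$ when it has this density on $(0,1)^2$. *)

theory Defs
  imports "HOL-Probability.Probability"
begin

text \<open>
  \<open>gnb_build D \<mu> vs E\<close>: the vertices \<open>vs = [i\<^sub>1, \<dots>, i\<^sub>k]\<close> of \<open>D\<close> have been added, in this order, and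
  the resulting graph on \<open>{0} \<union> {i\<^sub>1, \<dots>, i\<^sub>k}\<close> has edge set \<open>E\<close>. The value \<open>\<mu> i\<^sub>1\<close> is irrelevant.
\<close>

inductive gnb_build :: "nat set \<Rightarrow> (nat \<Rightarrow> nat) \<Rightarrow> nat list \<Rightarrow> nat set set \<Rightarrow> bool"
  for D :: "nat set" and \<mu> :: "nat \<Rightarrow> nat"
where
  triangle: "\<lbrakk>i \<in> D; j \<in> D; i \<noteq> j; \<mu> j = i\<rbrakk>
    \<Longrightarrow> gnb_build D \<mu> [i, j] {{0, i}, {0, j}, {i, j}}"
| add_vertex: "\<lbrakk>gnb_build D \<mu> vs E; j \<in> D; j \<notin> set vs; \<mu> j \<in> set vs\<rbrakk>
    \<Longrightarrow> gnb_build D \<mu> (vs @ [j]) (E \<union> {{0, j}, {j, \<mu> j}})"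

definition gnb_graph :: "nat \<Rightarrow> (nat \<Rightarrow> nat) \<Rightarrow> nat list \<Rightarrow> nat set set \<Rightarrow> bool" where
  "gnb_graph d \<mu> vs E \<longleftrightarrow> gnb_build {1..d} \<mu> vs E \<and> set vs = {1..d}"

definition clique :: "nat set \<Rightarrow> nat set set \<Rightarrow> nat set \<Rightarrow> bool" where
  "clique V E C \<longleftrightarrow> C \<subseteq> V \<and> (\<forall>u\<in>C. \<forall>v\<in>C. u \<noteq> v \<longrightarrow> {u, v} \<in> E)"

definition maximal_clique :: "nat set \<Rightarrow> nat set set \<Rightarrow> nat set \<Rightarrow> bool" where
  "maximal_clique V E C \<longleftrightarrow> clique V E C \<and> (\<forall>C'. clique V E C' \<and> C \<subseteq> C' \<longrightarrow> C' = C)"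

definition clusters :: "nat \<Rightarrow> nat set set \<Rightarrow> nat set set" where
  "clusters d E = {C. maximal_clique {0..d} E C \<and> card C = 3}"

definition multiplicity_of :: "nat \<Rightarrow> nat set set \<Rightarrow> nat set \<Rightarrow> nat" where
  "multiplicity_of d E S = card {C \<in> clusters d E. S \<subseteq> C}"

definition separators :: "nat \<Rightarrow> nat set set \<Rightarrow> nat set set" where
  "separators d E = {S. (\<exists>s\<in>{1..d}. S = {0, s}) \<and> 2 \<le> multiplicity_of d E S}"

lemma gnb_build_props:
  assumes "gnb_build D \<mu> vs E"
  shows "vs \<noteq> [] \<and> set vs \<subseteq> D \<and> (\<forall>i\<in>set (tl vs). \<mu> i \<in> set vs)
    \<and> E = (\<lambda>i. {0, i}) ` set vs \<union> (\<lambda>i. {i, \<mu> i}) ` set (tl vs)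
    \<and> (\<exists>r :: nat \<Rightarrow> nat. \<forall>i\<in>set (tl vs). r (\<mu> i) < r i)"
  using assms
proof induction
  case (triangle i j)
  have "\<exists>r :: nat \<Rightarrow> nat. r i < r j"
    using triangle by (intro exI[of _ "\<lambda>k. if k = i then 0 else 1"]) auto
  then show ?case using triangle by auto
next
  case (add_vertex vs E j)
  have tl: "set (tl (vs @ [j])) = insert j (set (tl vs))"
    using add_vertex.IH by (cases vs) auto
  have sub: "set (tl vs) \<subseteq> set vs" by (cases vs) auto
  obtain r :: "nat \<Rightarrow> nat" where r: "\<forall>i\<in>set (tl vs). r (\<mu> i) < r i"
    using add_vertex.IH by blast
  define r' where "r' = r(j := Suc (r (\<mu> j)))"
  have "r' (\<mu> i) < r' i" if "i \<in> insert j (set (tl vs))" for i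
  proof (cases "i = j")
    case True
    then show ?thesis using add_vertex.hyps by (auto simp: r'_def)
  next
    case False
    then have "i \<in> set (tl vs)" using that by simp
    moreover from this have "\<mu> i \<noteq> j" using add_vertex by auto
    ultimately show ?thesis using r False by (simp add: r'_def)
  qed
  then have "\<exists>r :: nat \<Rightarrow> nat. \<forall>i\<in>set (tl (vs @ [j])). r (\<mu> i) < r i"
    unfolding tl by blast
  moreover have "E \<union> {{0, j}, {j, \<mu> j}}
      = (\<lambda>i. {0, i}) ` set (vs @ [j]) \<union> (\<lambda>i. {i, \<mu> i}) ` set (tl (vs @ [j]))"
    unfolding tl using add_vertex.IH by (simp add: insert_commute)
  moreover have "\<forall>i\<in>set (tl (vs @ [j])). \<mu> i \<in> set (vs @ [j])"
    unfolding tl using add_vertex by auto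
  ultimately show ?case using add_vertex by simp
qed

lemma gnb_clusters:
  assumes "gnb_graph d \<mu> vs E"
  shows "clusters d E = (\<lambda>i. {0, i, \<mu> i}) ` set (tl vs)"
    and "inj_on (\<lambda>i. {0, i, \<mu> i}) (set (tl vs))"
proof -
  let ?T = "(\<lambda>i. {i, \<mu> i}) ` set (tl vs)"
  have b: "gnb_build {1..d} \<mu> vs E" and D: "set vs = {1..d}"
    using assms by (auto simp: gnb_graph_def)
  note P = gnb_build_props[OF b]
  obtain r :: "nat \<Rightarrow> nat" where r: "\<And>i. i \<in> set (tl vs) \<Longrightarrow> r (\<mu> i) < r i" using P by blast
  have sub: "set (tl vs) \<subseteq> {1..d}" using D by (cases vs) auto
  have mu: "\<mu> i \<in> {1..d}" "\<mu> i \<noteq> i" if "i \<in> set (tl vs)" for i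
    using P D that r[OF that] by auto
  have E: "E = (\<lambda>i. {0, i}) ` {1..d} \<union> ?T" using P D by simp
  have ET: "{a, b} \<in> ?T" if "{a, b} \<in> E" "a \<noteq> 0" "b \<noteq> 0" for a b
  proof -
    have "{a, b} \<notin> (\<lambda>i. {0, i}) ` {1..d}"
    proof
      assume "{a, b} \<in> (\<lambda>i. {0, i}) ` {1..d}"
      then have "0 \<in> {a, b}" by blast
      then show False using that(2,3) by simp
    qed
    then show ?thesis using that(1) unfolding E Un_iff by simp
  qed
  have T_cases: "r b < r a \<and> b = \<mu> a \<or> r a < r b \<and> a = \<mu> b" if "{a, b} \<in> ?T" for a b
  proof -
    have "\<exists>i\<in>set (tl vs). {a, b} = {i, \<mu> i}" using that by (simp only: image_iff)
    then obtain i where i: "i \<in> set (tl vs)" "{a, b} = {i, \<mu> i}" by (rule bexE)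
    from i(2) have "a = i \<and> b = \<mu> i \<or> a = \<mu> i \<and> b = i" by (simp only: doubleton_eq_iff)
    then show ?thesis using r[OF i(1)] by metis
  qed
  have no_tri: False if "{a, b} \<in> ?T" "{b, c} \<in> ?T" "{a, c} \<in> ?T" "a \<noteq> b" "b \<noteq> c" "a \<noteq> c" for a b c
    using T_cases[OF that(1)] T_cases[OF that(2)] T_cases[OF that(3)] that(4-6)
    by (elim disjE conjE) (linarith | metis)+
  show "inj_on (\<lambda>i. {0, i, \<mu> i}) (set (tl vs))"
  proof (rule inj_onI, rule ccontr)
    fix i j assume a: "i \<in> set (tl vs)" "j \<in> set (tl vs)" "{0, i, \<mu> i} = {0, j, \<mu> j}" "i \<noteq> j"
    have "i \<noteq> 0" "j \<noteq> 0" using a sub by auto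
    moreover have "j \<in> {0, i, \<mu> i}" unfolding a(3) by simp
    moreover have "i \<in> {0, j, \<mu> j}" unfolding a(3)[symmetric] by simp
    ultimately have "j = \<mu> i" "i = \<mu> j" using a(4) by (metis empty_iff insert_iff)+
    then show False using r[OF a(1)] r[OF a(2)] by (metis less_asym)
  qed
  show "clusters d E = (\<lambda>i. {0, i, \<mu> i}) ` set (tl vs)"
  proof (intro equalityI subsetI)
    fix C assume "C \<in> clusters d E"
    then have c: "clique {0..d} E C" and m: "\<And>C'. clique {0..d} E C' \<Longrightarrow> C \<subseteq> C' \<Longrightarrow> C' = C"
      and k: "card C = 3" by (auto simp: clusters_def maximal_clique_def)
    have "0 \<in> C"
    proof -
      have "clique {0..d} E (insert 0 C)"
        unfolding clique_def
      proof (intro conjI ballI impI)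
        show "insert 0 C \<subseteq> {0..d}" using c by (auto simp: clique_def)
        fix u v assume u: "u \<in> insert 0 C" "v \<in> insert 0 C" "u \<noteq> v"
        have C: "C \<subseteq> {0..d}" using c by (auto simp: clique_def)
        consider "u = 0" | "v = 0" | "u \<in> C" "v \<in> C" using u by auto
        then show "{u, v} \<in> E"
        proof cases
          case 1
          then have "v \<in> {1..d}" using u C by auto
          then show ?thesis using 1 unfolding E by simp
        next
          case 2
          then have "u \<in> {1..d}" using u C by auto
          then have "{0, u} \<in> E" unfolding E by simp
          then show ?thesis using 2 by (simp add: insert_commute)
        next
          case 3 then show ?thesis using c u by (auto simp: clique_def)
        qed
      qed
      then have "insert 0 C = C" by (rule m) (rule subset_insertI)
      then show ?thesis by (metis insertI1)
    qed
    moreover have "finite C" using k by (metis card.infinite zero_neq_numeral)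
    ultimately have "card (C - {0}) = 2" using k by simp
    then obtain a b where ab: "C - {0} = {a, b}" "a \<noteq> b" by (auto simp: card_2_iff)
    have "a \<in> C - {0}" "b \<in> C - {0}" unfolding ab(1) by simp_all
    then have nz: "a \<noteq> 0" "b \<noteq> 0" "a \<in> C" "b \<in> C" by simp_all
    have "{a, b} \<in> E" using c nz ab(2) by (simp add: clique_def)
    then have "{a, b} \<in> ?T" using nz by (intro ET)
    then have "\<exists>i\<in>set (tl vs). {a, b} = {i, \<mu> i}" by (simp only: image_iff)
    then obtain i where i: "i \<in> set (tl vs)" "{a, b} = {i, \<mu> i}" by (rule bexE)
    have "C = insert 0 (C - {0})" using \<open>0 \<in> C\<close> by (simp add: insert_absorb)
    then have "C = {0, i, \<mu> i}" unfolding ab(1) i(2) .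
    then show "C \<in> (\<lambda>i. {0, i, \<mu> i}) ` set (tl vs)" using i(1) by (rule image_eqI)
  next
    fix C assume "C \<in> (\<lambda>i. {0, i, \<mu> i}) ` set (tl vs)"
    then obtain i where i: "i \<in> set (tl vs)" and C: "C = {0, i, \<mu> i}" by auto
    have i0: "i \<in> {1..d}" "\<mu> i \<in> {1..d}" "\<mu> i \<noteq> i" using i sub mu by auto
    have "{0, k} \<in> E" if "k \<in> {1..d}" for k
      unfolding E by (intro UnI1 image_eqI[where x = k] refl that)
    moreover have "{i, \<mu> i} \<in> E"
      unfolding E by (intro UnI2 image_eqI[where x = i] refl i)
    ultimately have e: "{0, i} \<in> E" "{0, \<mu> i} \<in> E" "{i, \<mu> i} \<in> E" using i0 by simp_all
    have c: "clique {0..d} E C"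
      unfolding clique_def C using e i0 by (simp add: insert_commute)
    have "C' = C" if c': "clique {0..d} E C'" "C \<subseteq> C'" for C'
    proof (rule ccontr)
      assume "C' \<noteq> C"
      then obtain x where x: "x \<in> C'" "x \<notin> C" using c'(2) by blast
      have n: "x \<noteq> i" "x \<noteq> \<mu> i" "x \<noteq> 0" "i \<noteq> 0" "\<mu> i \<noteq> 0" using x C i0 by auto
      have "{i, \<mu> i} \<in> E" "{\<mu> i, x} \<in> E" "{i, x} \<in> E"
        using e c' x n unfolding clique_def C by simp_all
      then have "{i, \<mu> i} \<in> ?T" "{\<mu> i, x} \<in> ?T" "{i, x} \<in> ?T" using n by (intro ET; simp)+
      then show False by (rule no_tri) (use n i0(3) in simp_all)
    qed
    then have "maximal_clique {0..d} E C" using c by (auto simp: maximal_clique_def)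
    moreover have "card C = 3" unfolding C using i0 by auto
    ultimately show "C \<in> clusters d E" by (auto simp: clusters_def)
  qed
qed

definition cond_space :: "'a measure \<Rightarrow> ('a \<Rightarrow> 'y) \<Rightarrow> 'y \<Rightarrow> 'a measure" where
  "cond_space M Y y = uniform_measure M (Y -` {y} \<inter> space M)"

text \<open>
  \<^const>\<open>prob_space.entropy\<close> is the entropy relative to a reference measure: \<^const>\<open>lborel\<close> gives the
  differential entropy, counting measure the discrete one, and a product of both the mixed one.
\<close>

definition mixed_entropy ::
  "'a measure \<Rightarrow> real \<Rightarrow> (nat \<Rightarrow> 'a \<Rightarrow> real) \<Rightarrow> 'y set \<Rightarrow> ('a \<Rightarrow> 'y) \<Rightarrow> nat set \<Rightarrow> real" where
  "mixed_entropy M b X \<Y> Y A = prob_space.entropy M b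
     ((\<Pi>\<^sub>M i\<in>A. lborel) \<Otimes>\<^sub>M count_space \<Y>) (\<lambda>\<omega>. (\<lambda>i\<in>A. X i \<omega>, Y \<omega>))"

definition mixed_info ::
  "'a measure \<Rightarrow> real \<Rightarrow> (nat \<Rightarrow> 'a \<Rightarrow> real) \<Rightarrow> 'y set \<Rightarrow> ('a \<Rightarrow> 'y) \<Rightarrow> nat set \<Rightarrow> real" where
  "mixed_info M b X \<Y> Y A = (\<Sum>i\<in>A. prob_space.entropy M b lborel (X i))
     + prob_space.entropy M b (count_space \<Y>) Y - mixed_entropy M b X \<Y> Y A"

text \<open>
  Index \<open>0\<close> stands for \<open>Y\<close> and lies in every cluster and separator, so \<open>\<^bold>X\<^sub>C\<close> is the mixed vector
  formed by \<open>Y\<close> and the \<open>X\<^sub>i\<close> with \<open>i \<in> C - {0}\<close>.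
\<close>

definition gnb_weight ::
  "'a measure \<Rightarrow> real \<Rightarrow> (nat \<Rightarrow> 'a \<Rightarrow> real) \<Rightarrow> 'y set \<Rightarrow> ('a \<Rightarrow> 'y) \<Rightarrow> nat \<Rightarrow> nat set set \<Rightarrow> real" where
  "gnb_weight M b X \<Y> Y d E =
     (\<Sum>C\<in>clusters d E. mixed_info M b X \<Y> Y (C - {0}))
     - (\<Sum>S\<in>separators d E. (real (multiplicity_of d E S) - 1) * mixed_info M b X \<Y> Y (S - {0}))"

definition pair_info :: "'a measure \<Rightarrow> real \<Rightarrow> ('a \<Rightarrow> real) \<Rightarrow> ('a \<Rightarrow> real) \<Rightarrow> real" where
  "pair_info M b U V = prob_space.entropy M b lborel U + prob_space.entropy M b lborel V
     - prob_space.entropy M b (lborel \<Otimes>\<^sub>M lborel) (\<lambda>\<omega>. (U \<omega>, V \<omega>))"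

text \<open>
  A density on the whole plane; it vanishes almost everywhere outside the unit square, because
  the transformed variables take values in \<open>[0, 1]\<close>.
\<close>

definition copula_density ::
  "'a measure \<Rightarrow> ('a \<Rightarrow> real) \<Rightarrow> ('a \<Rightarrow> real) \<Rightarrow> real \<times> real \<Rightarrow> ennreal" where
  "copula_density M X Z = RN_deriv (lborel \<Otimes>\<^sub>M lborel)
     (distr M (lborel \<Otimes>\<^sub>M lborel)
       (\<lambda>\<omega>. (cdf (distr M borel X) (X \<omega>), cdf (distr M borel Z) (Z \<omega>))))"

definition copula_info :: "real \<Rightarrow> (real \<times> real \<Rightarrow> ennreal) \<Rightarrow> real" where
  "copula_info b c = pair_info (density (lborel \<Otimes>\<^sub>M lborel) c) b fst snd"

end

theory Submission
  imports Defs
begin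

text \<open>
  Given \<open>Y\<close>, the mixed entropies split as \<open>H(\<^bold>X\<^sub>A, Y) = H(Y) + \<Sum>\<^sub>y p(y) H(\<^bold>X\<^sub>A | y)\<close>, so \<open>H(Y)\<close> cancels in
  every information content. As every \<open>s \<in> D\<close> lies in \<open>\<nu>\<^sub>s \<ge> 1\<close> clusters, subtracting the separators
  leaves each \<open>I(X\<^sub>s, Y)\<close> exactly once, plus for every cluster the conditional mutual information of
  \<open>X\<^sub>i\<close> and \<open>X\<^sub>\<mu>\<^sub>i\<close>. The latter is a Kullback-Leibler divergence, and it is not changed by the
  transformation to copula scale because the conditional c.d.f. \<open>F\<close> is injective almost everywhere: the
  law of \<open>X\<close> is the image of the uniform law under the quantile function, on which \<open>F\<close> inverts it.
\<close>

section \<open>Kullback-Leibler divergence and the probability integral transform\<close>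

text \<open>With \<open>r\<close> the Radon-Nikodym derivative of \<open>N\<close> by
  \<open>M\<close>, the composition of \<open>r\<close> with \<open>T'\<close> is one for the image
  measures, and pulling it back along \<open>T\<close> returns \<open>r\<close>. A left inverse of
  \<open>T\<close> that works almost everywhere is enough, which is what a distribution function
  offers.\<close>

lemma KL_divergence_distr:
  assumes M: "sigma_finite_measure M" and D: "sigma_finite_measure (distr M S T)"
    and T[measurable]: "T \<in> measurable M S" and T'[measurable]: "T' \<in> measurable S M"
    and inv: "AE x in M. T' (T x) = x"
    and ac: "absolutely_continuous M N" and N: "sets N = sets M"
  shows "absolutely_continuous (distr M S T) (distr N S T)"
    and "KL_divergence b (distr M S T) (distr N S T) = KL_divergence b M N"
proof -
  interpret M: sigma_finite_measure M by fact
  interpret D: sigma_finite_measure "distr M S T" by fact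
  have [measurable_cong]: "sets N = sets M" by fact
  let ?r = "RN_deriv M N"
  \<comment> \<open>An image density must be a function of \<open>T x\<close>; inserting
    \<open>T' (T x)\<close> for \<open>x\<close> brings \<open>?r\<close> into this form without
    changing the measure.\<close>
  have "density M ?r = density M (\<lambda>x. ?r (T' (T x)))"
  proof (rule density_cong)
    show "AE x in M. ?r x = ?r (T' (T x))" using inv by eventually_elim simp
  qed simp_all
  then have eq: "density (distr M S T) (\<lambda>y. ?r (T' y)) = distr N S T"
    by (simp add: density_distr M.density_RN_deriv[OF ac N])
  show "absolutely_continuous (distr M S T) (distr N S T)"
    unfolding eq[symmetric] by (intro absolutely_continuousI_density) simp
  have "AE y in distr M S T. ?r (T' y) = RN_deriv (distr M S T) (distr N S T) y"
    by (rule D.RN_deriv_unique) (use eq in simp_all)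
  then have "AE x in M. ?r (T' (T x)) = RN_deriv (distr M S T) (distr N S T) (T x)"
    by (rule AE_distrD[OF T])
  with inv have "AE x in M. RN_deriv (distr M S T) (distr N S T) (T x) = ?r x"
    by eventually_elim simp
  \<comment> \<open>The divergence integrates against \<open>N\<close>, so the exceptional null set
    has to be one for \<open>N\<close> too; absolute continuity gives this.\<close>
  then have *: "AE x in N. RN_deriv (distr M S T) (distr N S T) (T x) = ?r x"
    by (rule absolutely_continuous_AE[OF N ac])
  have m: "RN_deriv (distr M S T) (distr N S T) \<in> borel_measurable S"
    using borel_measurable_RN_deriv[of "distr M S T" "distr N S T"] by simp
  show "KL_divergence b (distr M S T) (distr N S T) = KL_divergence b M N"
    unfolding KL_divergence_def entropy_density_def comp_def using m *
    by (subst integral_distr) (auto intro!: integral_cong_AE)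
qed

text \<open>\<open>N\<close> is concentrated on \<open>A\<close>, where the indicator is 1, so both
  reference measures yield the same derivative \<open>N\<close>-almost everywhere. This is applied
  to the unit square: copula entropies refer to Lebesgue measure on the plane, whereas the
  transformation of the marginals produces the uniform law on the square.\<close>

lemma KL_divergence_restrict:
  assumes M: "sigma_finite_measure M" and A[measurable]: "A \<in> sets M"
    and ac: "absolutely_continuous (density M (indicator A)) N" and N: "sets N = sets M"
  shows "absolutely_continuous M N"
    and "KL_divergence b M N = KL_divergence b (density M (indicator A)) N"
proof -
  interpret M: sigma_finite_measure M by fact
  let ?D = "density M (indicator A)"
  interpret D: sigma_finite_measure ?D
    by (subst M.sigma_finite_iff_density_finite) (auto split: split_indicator)
  let ?r = "RN_deriv ?D N"
  have [measurable]: "?r \<in> borel_measurable M"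
    using borel_measurable_RN_deriv[of ?D N] by simp
  have [measurable]: "RN_deriv M N \<in> borel_measurable N"
    using N borel_measurable_RN_deriv[of M N] by (simp cong: measurable_cong_sets)
  have [measurable]: "?r \<in> borel_measurable N"
    using N borel_measurable_RN_deriv[of ?D N] by (simp cong: measurable_cong_sets)
  have eq: "density M (\<lambda>x. indicator A x * ?r x) = N"
  proof (subst density_density_eq[symmetric])
    show "density ?D ?r = N" by (rule D.density_RN_deriv[OF ac]) (simp add: N)
  qed (rule borel_measurable_indicator[OF A], fact)
  show ac': "absolutely_continuous M N"
    by (subst eq[symmetric], intro absolutely_continuousI_density) simp
  have "AE x in M. indicator A x * ?r x = RN_deriv M N x"
    by (rule M.RN_deriv_unique) (use eq in simp_all)
  then have 1: "AE x in N. indicator A x * ?r x = RN_deriv M N x"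
    by (rule absolutely_continuous_AE[OF N ac'])
  have "AE x in ?D. x \<in> A" by (subst AE_density) (auto simp: indicator_def)
  then have 2: "AE x in N. x \<in> A"
    by (intro absolutely_continuous_AE[OF _ ac]) (simp_all add: N)
  from 1 2 have "AE x in N. RN_deriv M N x = ?r x"
    by eventually_elim simp
  then show "KL_divergence b M N = KL_divergence b ?D N"
    unfolding KL_divergence_def entropy_density_def comp_def
    by (intro integral_cong_AE) auto
qed

section \<open>Distribution function and quantile function of a law without atoms\<close>

context cdf_distribution
begin

text \<open>One inequality is the Galois connection between \<open>C\<close> and the quantile
  function \<open>I\<close>. For the other, \<open>C\<close> stays at most \<omega> to the left of
  \<open>I \<omega>\<close>, and without atoms it cannot jump over \<omega> there.\<close>

lemma cdf_quantile:
  assumes "\<And>x. measure M {x} = 0" "0 < \<omega>" "\<omega> < 1"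
  shows "C (I \<omega>) = \<omega>"
proof (rule antisym)
  show "\<omega> \<le> C (I \<omega>)"
    using pseudoinverse[of \<omega> "I \<omega>"] assms by simp
  have "isCont C (I \<omega>)" using assms by (simp add: isCont_cdf)
  then have "(C \<longlongrightarrow> C (I \<omega>)) (at_left (I \<omega>))"
    by (simp add: isCont_def filterlim_at_split)
  moreover have "\<forall>\<^sub>F x in at_left (I \<omega>). C x \<le> \<omega>"
    unfolding eventually_at_filter
  proof (intro always_eventually allI impI)
    fix x assume "x \<noteq> I \<omega>" "x \<in> {..<I \<omega>}"
    then show "C x \<le> \<omega>" using pseudoinverse[of \<omega> x] assms(2,3) by simp
  qed
  ultimately show "C (I \<omega>) \<le> \<omega>"
    by (rule tendsto_upperbound) simp
qed

text \<open>\<open>M\<close> is the image of the uniform law under \<open>I\<close>, and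
  \<open>C\<close> undoes \<open>I\<close> on the open unit interval.\<close>

lemma distr_cdf_uniform:
  assumes "\<And>x. measure M {x} = 0"
  shows "distr M lborel C = density lborel (indicator {0<..<1})"
proof -
  let ?U = "restrict_space lborel {0<..<1::real}"
  have "distr M lborel C = distr (distr ?U borel I) lborel C"
    by (simp add: distr_I_eq_M)
  also have "\<dots> = distr ?U lborel (\<lambda>\<omega>. C (I \<omega>))"
  proof (subst distr_distr)
    show "I \<in> measurable ?U borel"
      by (simp cong: measurable_cong_sets) 
  qed (auto simp: comp_def)
  also have "\<dots> = distr ?U lborel (\<lambda>\<omega>. \<omega>)"
    using assms by (intro distr_cong) (auto simp: space_restrict_space cdf_quantile)
  also have "\<dots> = density lborel (indicator {0<..<1})"
    by (intro measure_eqI)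
      (auto simp: emeasure_distr emeasure_restrict_space space_restrict_space emeasure_density
        Int_commute measurable_restrict_space1 indicator_inter_arith[symmetric])
  finally show ?thesis .
qed

text \<open>\<open>C\<close> may be constant on intervals, so it need not be injective. But a point
  drawn from \<open>M\<close> has the form \<open>I \<omega>\<close> with \<omega> uniform, and
  \<open>C (I \<omega>) = \<omega>\<close> recovers \<omega>, hence the point.\<close>

lemma AE_quantile_cdf:
  assumes "\<And>x. measure M {x} = 0"
  obtains Q where "Q \<in> borel_measurable borel" "AE x in M. Q (C x) = x"
proof
  let ?U = "restrict_space lborel {0<..<1::real}"
  \<comment> \<open>The value 0 outside the unit interval is a mere default that makes
    \<open>I\<close> measurable on the whole line.\<close>
  let ?Q = "\<lambda>\<omega>. if \<omega> \<in> {0<..<1} then I \<omega> else 0"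
  have I: "I \<in> measurable ?U borel" by (simp cong: measurable_cong_sets)
  show Q: "?Q \<in> borel_measurable borel"
    by (subst measurable_If_restrict_space_iff)
      (use measurable_CI in \<open>simp_all del: greaterThanLessThan_iff\<close>)
  have "AE \<omega> in ?U. ?Q (C (I \<omega>)) = I \<omega>"
    using assms by (intro AE_I2) (auto simp: space_restrict_space cdf_quantile)
  moreover have "{x \<in> space borel. ?Q (C x) = x} \<in> sets borel"
    using measurable_compose[OF measurable_C Q] by (rule borel_measurable_eq) simp
  ultimately have "AE x in distr ?U borel I. ?Q (C x) = x"
    by (simp only: AE_distr_iff[OF I])
  then show "AE x in M. ?Q (C x) = x" by (simp only: distr_I_eq_M)
qed
end

section \<open>Copula information\<close>

lemma AE_pair_measure_prod:
  assumes A: "sigma_finite_measure A" and B: "sigma_finite_measure B"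
    and P: "AE x in A. P x" and Q: "AE y in B. Q y"
    and [measurable]: "Measurable.pred A P" "Measurable.pred B Q"
  shows "AE z in A \<Otimes>\<^sub>M B. P (fst z) \<and> Q (snd z)"
proof -
  interpret A: sigma_finite_measure A by fact
  interpret B: sigma_finite_measure B by fact
  interpret pair_sigma_finite A B ..
  show ?thesis
  proof (rule AE_pair_measure)
    show "AE x in A. AE y in B. P (fst (x, y)) \<and> Q (snd (x, y))"
      using P Q by auto
  qed measurable
qed

text \<open>Mutual information is defined as the divergence of the joint law from the product of the
  marginals. The logarithm of \<open>h / (f g)\<close> splits into three integrable parts because
  all three entropies are finite. Absolute continuity is recorded as well, since the invariance of
  the divergence under \<open>T\<close> relies on it.\<close>

lemma (in information_space) mutual_information_eq_pair_info:
  assumes S: "sigma_finite_measure S" and T: "sigma_finite_measure T"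
    and X: "finite_entropy S X f" and Z: "finite_entropy T Z g"
    and XZ: "finite_entropy (S \<Otimes>\<^sub>M T) (\<lambda>\<omega>. (X \<omega>, Z \<omega>)) h"
  shows "absolutely_continuous (distr M S X \<Otimes>\<^sub>M distr M T Z) (distr M (S \<Otimes>\<^sub>M T) (\<lambda>\<omega>. (X \<omega>, Z \<omega>)))"
    and "mutual_information b S T X Z
      = entropy b S X + entropy b T Z - entropy b (S \<Otimes>\<^sub>M T) (\<lambda>\<omega>. (X \<omega>, Z \<omega>))"
proof -
  interpret S: sigma_finite_measure S by fact
  interpret T: sigma_finite_measure T by fact
  interpret ST: pair_sigma_finite S T ..
  note D = finite_entropy_distributed[OF X] finite_entropy_distributed[OF Z] finite_entropy_distributed[OF XZ]
  note nn = finite_entropy_nn[OF X] finite_entropy_nn[OF Z] finite_entropy_nn[OF XZ]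
  note [measurable] = finite_entropy_measurable[OF X] finite_entropy_measurable[OF Z]
    finite_entropy_measurable[OF XZ]
  have [measurable]: "X \<in> measurable M S" "Z \<in> measurable M T"
    using D by (auto simp: distributed_def)
  let ?fg = "\<lambda>z. f (fst z) * g (snd z)"
  interpret DT: prob_space "density T (\<lambda>x. ennreal (g x))"
    unfolding distributed_distr_eq_density[OF D(2), symmetric] by (rule prob_space_distr) simp
  have eq: "distr M S X \<Otimes>\<^sub>M distr M T Z = density (S \<Otimes>\<^sub>M T) (\<lambda>z. ennreal (?fg z))"
    unfolding D(1,2)[THEN distributed_distr_eq_density]
    by (subst pair_measure_density)
      (auto simp: T.sigma_finite_measure_axioms DT.sigma_finite_measure_axioms
        ennreal_mult nn space_pair_measure split_beta' intro!: density_cong)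
  \<comment> \<open>The joint density vanishes almost everywhere that a marginal density does, so
    the quotient \<open>h / (f g)\<close> loses no mass at zeros of the denominator.\<close>
  have sub: "AE z in S \<Otimes>\<^sub>M T. ?fg z = 0 \<longrightarrow> h z = 0"
    using subdensity_finite_entropy[OF measurable_fst XZ X] subdensity_finite_entropy[OF measurable_snd XZ Z]
    by (auto simp: comp_def elim!: AE_mp)
  have "density (density (S \<Otimes>\<^sub>M T) ?fg) (\<lambda>z. h z / ?fg z) = density (S \<Otimes>\<^sub>M T) h"
    using sub by (intro density_density_divide) (auto simp: nn space_pair_measure intro!: AE_I2)
  moreover have "absolutely_continuous (density (S \<Otimes>\<^sub>M T) ?fg) (density (density (S \<Otimes>\<^sub>M T) ?fg) (\<lambda>z. h z / ?fg z))"
    by (rule absolutely_continuousI_density) measurable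
  ultimately show "absolutely_continuous (distr M S X \<Otimes>\<^sub>M distr M T Z) (distr M (S \<Otimes>\<^sub>M T) (\<lambda>\<omega>. (X \<omega>, Z \<omega>)))"
    unfolding eq distributed_distr_eq_density[OF D(3)] by simp
  show "mutual_information b S T X Z
      = entropy b S X + entropy b T Z - entropy b (S \<Otimes>\<^sub>M T) (\<lambda>\<omega>. (X \<omega>, Z \<omega>))"
  proof (rule mutual_information_eq_entropy_conditional_entropy_distr[OF S T D(1) _ D(2) _ D(3)])
    show "integrable (S \<Otimes>\<^sub>M T) (\<lambda>x. h x * log b (f (fst x)))"
      by (rule finite_entropy_integrable_transform[OF X D(3) nn(3)]) auto
    show "integrable (S \<Otimes>\<^sub>M T) (\<lambda>x. h x * log b (g (snd x)))"
      by (rule finite_entropy_integrable_transform[OF Z D(3) nn(3)]) auto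
  qed (use nn finite_entropy_integrable[OF XZ] in \<open>auto simp: space_pair_measure\<close>)
qed

lemma (in prob_space) cdf_transform:
  assumes X: "distributed M lborel X f"
  shows "cdf (distr M borel X) \<in> borel_measurable borel"
    and "distr (distr M lborel X) lborel (cdf (distr M borel X)) = density lborel (indicator {0<..<1})"
    and "\<exists>Q \<in> borel_measurable borel. AE x in distr M lborel X. Q (cdf (distr M borel X) x) = x"
proof -
  have X'[measurable]: "X \<in> borel_measurable M" using X by (simp add: distributed_def)
  \<comment> \<open>The distribution function is taken of the law on \<open>borel\<close>, entropies
    of the law on \<open>lborel\<close>; the two laws coincide.\<close>
  have eq: "distr M borel X = distr M lborel X" by (intro distr_cong) simp_all
  interpret r: real_distribution "distr M borel X" by (rule real_distribution_distr) simp
  interpret c: cdf_distribution "distr M borel X" ..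
  show "cdf (distr M borel X) \<in> borel_measurable borel" by (rule c.measurable_C)
  \<comment> \<open>A law with a density has no atoms, because points are Lebesgue null
    sets.\<close>
  have "emeasure (distr M lborel X) {x} = 0" for x
    using X unfolding distributed_def
    by (auto simp: emeasure_density intro!: nn_integral_null_set simp: null_sets_def)
  then have *: "measure (distr M borel X) {x} = 0" for x
    by (simp add: eq measure_def)
  show "distr (distr M lborel X) lborel (cdf (distr M borel X)) = density lborel (indicator {0<..<1})"
    using c.distr_cdf_uniform[OF *] by (simp add: eq)
  show "\<exists>Q \<in> borel_measurable borel. AE x in distr M lborel X. Q (cdf (distr M borel X) x) = x"
    using c.AE_quantile_cdf[OF *] unfolding eq[symmetric] by metis
qed

text \<open>The density only takes the values 0 and 1, so \<open>p log p\<close> vanishes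
  identically. Hence the uniform marginals contribute nothing to the information content of a
  copula.\<close>

lemma KL_lborel_uniform:
  assumes "1 < b"
  shows "KL_divergence b lborel (density lborel (indicator {0<..<1::real})) = 0"
proof -
  have "density lborel (indicator {0<..<1::real}) = density lborel (\<lambda>x. ennreal (indicator {0<..<1} x))"
    by (intro density_cong) (auto simp: indicator_def)
  then have "KL_divergence b lborel (density lborel (indicator {0<..<1::real}))
    = KL_divergence b lborel (density lborel (\<lambda>x. ennreal (indicator {0<..<1::real} x)))"
    by (simp only:)
  also have "\<dots> = (\<integral>x. indicator {0<..<1::real} x * log b (indicator {0<..<1} x) \<partial>lborel)"
    by (rule lborel.KL_density[OF assms]) auto
  also have "\<dots> = (\<integral>x. 0 \<partial>(lborel :: real measure))"
    by (intro Bochner_Integration.integral_cong) (auto simp: indicator_def)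
  finally show ?thesis by simp
qed

text \<open>Both sides are divergences. The componentwise distribution functions \<open>?T\<close>
  carry the product of the marginals to the uniform law on the unit square and the joint law to the
  copula law \<open>?C\<close>; since \<open>?T\<close> is invertible almost everywhere, the
  divergence is preserved.\<close>

lemma copula_info_eq_pair_info:
  assumes inf: "information_space M b"
    and X: "information_space.finite_entropy M b lborel X f"
    and Z: "information_space.finite_entropy M b lborel Z g"
    and XZ: "information_space.finite_entropy M b (lborel \<Otimes>\<^sub>M lborel) (\<lambda>\<omega>. (X \<omega>, Z \<omega>)) h"
  shows "copula_info b (copula_density M X Z) = pair_info M b X Z"
proof -
  interpret information_space M b by fact
  let ?F = "cdf (distr M borel X)" and ?G = "cdf (distr M borel Z)"
  let ?L = "lborel \<Otimes>\<^sub>M lborel :: (real \<times> real) measure"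
  let ?sq = "{0<..<1} \<times> {0<..<1} :: (real \<times> real) set"
  let ?T = "\<lambda>(x, z). (?F x, ?G z)"
  let ?R = "distr M lborel X \<Otimes>\<^sub>M distr M lborel Z" and ?P = "distr M ?L (\<lambda>\<omega>. (X \<omega>, Z \<omega>))"
  let ?C = "distr M ?L (\<lambda>\<omega>. (?F (X \<omega>), ?G (Z \<omega>)))"
  note dX = finite_entropy_distributed[OF X] and dZ = finite_entropy_distributed[OF Z]
  have mX[measurable]: "X \<in> borel_measurable M" and mZ[measurable]: "Z \<in> borel_measurable M"
    using dX dZ by (auto simp: distributed_def)
  note [measurable] = cdf_transform(1)[OF dX] cdf_transform(1)[OF dZ]
  obtain Q Q' where [measurable]: "Q \<in> borel_measurable borel" "Q' \<in> borel_measurable borel"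
    and Q: "AE x in distr M lborel X. Q (?F x) = x" and Q': "AE z in distr M lborel Z. Q' (?G z) = z"
    using cdf_transform(3)[OF dX] cdf_transform(3)[OF dZ] by blast
  interpret DX: prob_space "distr M lborel X" by (rule prob_space_distr) simp
  interpret DZ: prob_space "distr M lborel Z" by (rule prob_space_distr) simp
  interpret R: pair_prob_space "distr M lborel X" "distr M lborel Z" ..
  have L: "sigma_finite_measure ?L" unfolding lborel_prod by (rule lborel.sigma_finite_measure_axioms)
  have T[measurable]: "?T \<in> measurable ?R ?L" by measurable
  have DU: "sigma_finite_measure (distr (distr M lborel Z) lborel ?G)"
    by (intro prob_space_imp_sigma_finite DZ.prob_space_distr) simp
  have RT: "distr ?R ?L ?T = density ?L (indicator ?sq)"
  proof -
    have "distr ?R ?L ?T = density lborel (indicator {0<..<1}) \<Otimes>\<^sub>M density lborel (indicator {0<..<1})"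
      using pair_measure_distr[OF _ _ DU, of ?F "distr M lborel X" lborel]
      unfolding cdf_transform(2)[OF dX] cdf_transform(2)[OF dZ] by simp
    also have "\<dots> = density ?L (\<lambda>(x, z). indicator {0<..<1} x * indicator {0<..<1} z)"
      using DU unfolding cdf_transform(2)[OF dZ]
      by (intro pair_measure_density) (auto intro: lborel.sigma_finite_measure_axioms)
    also have "\<dots> = density ?L (indicator ?sq)"
      by (intro density_cong) (auto simp: indicator_def)
    finally show ?thesis .
  qed
  have PT: "distr ?P ?L ?T = ?C"
    by (subst distr_distr) (auto simp: comp_def)
  have RTsf: "sigma_finite_measure (distr ?R ?L ?T)"
    by (intro prob_space_imp_sigma_finite R.prob_space_distr T)
  have inv: "AE x in ?R. (\<lambda>(u, v). (Q u, Q' v)) (?T x) = x"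
  proof -
    have "AE x in ?R. Q (?F (fst x)) = fst x \<and> Q' (?G (snd x)) = snd x"
      using Q Q' by (intro AE_pair_measure_prod DX.sigma_finite_measure_axioms DZ.sigma_finite_measure_axioms)
        measurable
    then show ?thesis by eventually_elim (simp add: split_beta prod_eq_iff)
  qed
  note mi = mutual_information_eq_pair_info[OF lborel.sigma_finite_measure_axioms
      lborel.sigma_finite_measure_axioms X Z XZ]
  have T': "(\<lambda>(u, v). (Q u, Q' v)) \<in> measurable ?L ?R" by measurable
  have setsPR: "sets ?P = sets ?R"
    by (simp cong: sets_pair_measure_cong)
  note kl = KL_divergence_distr[OF R.sigma_finite_measure_axioms RTsf T T' inv mi(1) setsPR,
      unfolded PT RT]
  have sq: "?sq \<in> sets ?L" by measurable
  note kr = KL_divergence_restrict[OF L sq kl(1)]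
  \<comment> \<open>\<open>kr\<close> replaces Lebesgue measure by the uniform law on the square,
    and \<open>kl\<close> leads from there back to the original pair of laws.\<close>
  have joint: "KL_divergence b ?L ?C = mutual_information b lborel lborel X Z"
    using kr(2) kl(2)[of b] by (simp add: mutual_information_def)
  \<comment> \<open>Absolute continuity of \<open>?C\<close> guarantees that its Radon-Nikodym
    derivative represents the whole law, with no singular part lost.\<close>
  have C: "density ?L (copula_density M X Z) = ?C"
    unfolding copula_density_def by (rule sigma_finite_measure.density_RN_deriv[OF L kr(1)]) simp_all
  interpret C: prob_space ?C by (rule prob_space_distr) simp
  have fst: "distr ?C lborel fst = density lborel (indicator {0<..<1})"
    unfolding cdf_transform(2)[OF dX, symmetric]
    by (subst (1 2) distr_distr) (auto simp: comp_def)
  have snd: "distr ?C lborel snd = density lborel (indicator {0<..<1})"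
    unfolding cdf_transform(2)[OF dZ, symmetric]
    by (subst (1 2) distr_distr) (auto simp: comp_def)
  have id: "distr ?C ?L (\<lambda>\<omega>. (fst \<omega>, snd \<omega>)) = ?C"
    by (subst distr_distr) (auto simp: comp_def)
  show ?thesis
    unfolding copula_info_def pair_info_def C C.entropy_def fst snd id joint mi(2)
    by (simp add: KL_lborel_uniform[OF b_gt_1] entropy_def)
qed

section \<open>Mixed entropies\<close>

lemma information_space_cond_space:
  assumes "information_space M b" and [measurable]: "Y \<in> measurable M (count_space \<Y>)"
    and p: "0 < measure M (Y -` {y} \<inter> space M)"
  shows "information_space (cond_space M Y y) b"
proof -
  interpret information_space M b by fact
  have "prob_space (cond_space M Y y)"
    unfolding cond_space_def using p by (intro prob_space_uniform_measure) (auto simp: emeasure_eq_measure)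
  then interpret c: prob_space "cond_space M Y y" .
  show ?thesis by unfold_locales (rule b_gt_1)
qed

lemma sets_cond_space[simp, measurable_cong]: "sets (cond_space M Y y) = sets M"
  by (simp add: cond_space_def)

lemma space_cond_space[simp]: "space (cond_space M Y y) = space M"
  by (simp add: cond_space_def)

lemma emeasure_level_Int:
  assumes "prob_space M" and [measurable]: "Y \<in> measurable M (count_space \<Y>)"
    and p: "0 < measure M (Y -` {y} \<inter> space M)" and y: "y \<in> \<Y>" and B: "B \<in> sets M"
  shows "emeasure M ((Y -` {y} \<inter> space M) \<inter> B)
    = ennreal (measure M (Y -` {y} \<inter> space M)) * emeasure (cond_space M Y y) B"
proof -
  interpret prob_space M by fact
  let ?A = "Y -` {y} \<inter> space M"
  have A: "?A \<in> events" using y by measurable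
  have "emeasure (cond_space M Y y) B = emeasure M (?A \<inter> B) / emeasure M ?A"
    using A B by (simp add: cond_space_def)
  then show ?thesis
    using p by (simp add: emeasure_eq_measure divide_ennreal ennreal_mult[symmetric])
qed

text \<open>An event for \<open>(W, Y)\<close> is a finite disjoint union of slices, one for each
  value of \<open>Y\<close>; on a slice the law is \<open>p(y)\<close> times the conditional law of
  \<open>W\<close>. Tonelli's theorem reassembles the slice integrals.\<close>

lemma distributed_mixed:
  assumes inf: "information_space M b" and S: "sigma_finite_measure S"
    and Y[measurable]: "Y \<in> measurable M (count_space \<Y>)" and fin: "finite \<Y>"
    and p: "\<And>y. y \<in> \<Y> \<Longrightarrow> 0 < measure M (Y -` {y} \<inter> space M)"
    and W[measurable]: "W \<in> measurable M S"
    and f: "\<And>y. y \<in> \<Y> \<Longrightarrow> distributed (cond_space M Y y) S W (f y)"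
  shows "distributed M (S \<Otimes>\<^sub>M count_space \<Y>) (\<lambda>\<omega>. (W \<omega>, Y \<omega>))
    (\<lambda>(x, y). ennreal (measure M (Y -` {y} \<inter> space M)) * f y x)"
  unfolding distributed_def
proof (intro conjI)
  interpret information_space M b by fact
  interpret S: sigma_finite_measure S by fact
  interpret C: sigma_finite_measure "count_space \<Y>"
    using fin by (rule sigma_finite_measure_count_space_finite)
  interpret P: pair_sigma_finite S "count_space \<Y>" ..
  let ?p = "\<lambda>y. measure M (Y -` {y} \<inter> space M)"
  let ?g = "\<lambda>(x, y). ennreal (?p y) * f y x"
  have fm: "f y \<in> borel_measurable S" if "y \<in> \<Y>" for y
    using f[OF that] by (simp add: distributed_def)
  \<comment> \<open>Joint measurability follows from that of the sections \<open>f y\<close> because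
    \<Y> is countable.\<close>
  show g[measurable]: "?g \<in> borel_measurable (S \<Otimes>\<^sub>M count_space \<Y>)"
    by (rule measurable_compose_countable'[where f="\<lambda>y z. ennreal (?p y) * f y (fst z)" and g=snd and I=\<Y>,
          THEN measurable_cong[THEN iffD1, rotated]])
      (auto intro!: countable_finite fin measurable_compose[OF measurable_fst fm]
         borel_measurable_times_ennreal)
  show "(\<lambda>\<omega>. (W \<omega>, Y \<omega>)) \<in> measurable M (S \<Otimes>\<^sub>M count_space \<Y>)" by measurable
  show "distr M (S \<Otimes>\<^sub>M count_space \<Y>) (\<lambda>\<omega>. (W \<omega>, Y \<omega>)) = density (S \<Otimes>\<^sub>M count_space \<Y>) ?g"
  proof (rule measure_eqI)
    fix A assume "A \<in> sets (distr M (S \<Otimes>\<^sub>M count_space \<Y>) (\<lambda>\<omega>. (W \<omega>, Y \<omega>)))"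
    then have A[measurable]: "A \<in> sets (S \<Otimes>\<^sub>M count_space \<Y>)" by simp
    let ?B = "\<lambda>y. W -` ((\<lambda>x. (x, y)) -` A) \<inter> space M"
    have Ay[measurable]: "(\<lambda>x. (x, y)) -` A \<in> sets S" for y
      using A by (rule sets_Pair2)
    have B: "?B y \<in> events" for y by measurable
    have lev: "Y -` {y} \<inter> space M \<in> events" if "y \<in> \<Y>" for y using that by measurable
    have "emeasure (distr M (S \<Otimes>\<^sub>M count_space \<Y>) (\<lambda>\<omega>. (W \<omega>, Y \<omega>))) A
      = emeasure M ((\<lambda>\<omega>. (W \<omega>, Y \<omega>)) -` A \<inter> space M)"
      by (rule emeasure_distr) measurable
    also have "(\<lambda>\<omega>. (W \<omega>, Y \<omega>)) -` A \<inter> space M = (\<Union>y\<in>\<Y>. (Y -` {y} \<inter> space M) \<inter> ?B y)"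
      using measurable_space[OF Y] by auto
    also have "emeasure M \<dots> = (\<Sum>y\<in>\<Y>. emeasure M ((Y -` {y} \<inter> space M) \<inter> ?B y))"
      using fin lev B by (intro sum_emeasure[symmetric]) (auto simp: disjoint_family_on_def)
    also have "\<dots> = (\<Sum>y\<in>\<Y>. ennreal (?p y) * emeasure (cond_space M Y y) (?B y))"
      using B p by (intro sum.cong refl emeasure_level_Int[OF prob_space_axioms Y]) auto
    also have "\<dots> = (\<Sum>y\<in>\<Y>. \<integral>\<^sup>+x. ?g (x, y) * indicator A (x, y) \<partial>S)"
    proof (intro sum.cong refl)
      fix y assume y: "y \<in> \<Y>"
      have "emeasure (cond_space M Y y) (?B y) = emeasure (distr (cond_space M Y y) S W) ((\<lambda>x. (x, y)) -` A)"
        by (subst emeasure_distr) simp_all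
      also have "\<dots> = emeasure (density S (f y)) ((\<lambda>x. (x, y)) -` A)"
        using f[OF y] by (simp add: distributed_def)
      also have "\<dots> = (\<integral>\<^sup>+x. f y x * indicator ((\<lambda>x. (x, y)) -` A) x \<partial>S)"
        using fm[OF y] by (intro emeasure_density) simp_all
      finally have "ennreal (?p y) * emeasure (cond_space M Y y) (?B y)
          = (\<integral>\<^sup>+x. ennreal (?p y) * (f y x * indicator ((\<lambda>x. (x, y)) -` A) x) \<partial>S)"
        using fm[OF y] by (subst nn_integral_cmult) simp_all
      then show "ennreal (?p y) * emeasure (cond_space M Y y) (?B y)
          = (\<integral>\<^sup>+x. ?g (x, y) * indicator A (x, y) \<partial>S)"
        by (simp add: indicator_def mult.assoc)
    qed
    also have "\<dots> = (\<integral>\<^sup>+y. \<integral>\<^sup>+x. ?g (x, y) * indicator A (x, y) \<partial>S \<partial>count_space \<Y>)"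
      using fin by (simp add: nn_integral_count_space_finite)
    also have "\<dots> = (\<integral>\<^sup>+z. ?g z * indicator A z \<partial>(S \<Otimes>\<^sub>M count_space \<Y>))"
      by (rule P.nn_integral_snd) measurable
    also have "\<dots> = emeasure (density (S \<Otimes>\<^sub>M count_space \<Y>) ?g) A"
      by (rule emeasure_density[symmetric]) measurable
    finally show "emeasure (distr M (S \<Otimes>\<^sub>M count_space \<Y>) (\<lambda>\<omega>. (W \<omega>, Y \<omega>))) A
      = emeasure (density (S \<Otimes>\<^sub>M count_space \<Y>) ?g) A" .
  qed simp
qed

lemma distributed_discrete:
  assumes "prob_space M" and Y[measurable]: "Y \<in> measurable M (count_space \<Y>)" and fin: "finite \<Y>"
  shows "distributed M (count_space \<Y>) Y (\<lambda>y. ennreal (measure M (Y -` {y} \<inter> space M)))"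
  unfolding distributed_def
proof (intro conjI Y)
  interpret prob_space M by fact
  show "distr M (count_space \<Y>) Y = density (count_space \<Y>) (\<lambda>y. ennreal (measure M (Y -` {y} \<inter> space M)))"
    by (rule measure_eqI_finite[of _ \<Y>]) (auto simp: fin emeasure_distr emeasure_density
      emeasure_eq_measure nn_integral_count_space_finite indicator_def sum.If_cases)
qed simp

text \<open>The logarithm of \<open>p(y) f y x\<close> is a sum. As each \<open>f y\<close>
  integrates to 1, the first summand contributes the discrete entropy of \<open>Y\<close> and the
  second the averaged conditional entropies.\<close>

lemma entropy_mixed:
  fixes W :: "'a \<Rightarrow> 'b"
  assumes inf: "information_space M b" and S: "sigma_finite_measure S"
    and Y[measurable]: "Y \<in> measurable M (count_space \<Y>)" and fin: "finite \<Y>"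
    and p: "\<And>y. y \<in> \<Y> \<Longrightarrow> 0 < measure M (Y -` {y} \<inter> space M)"
    and W[measurable]: "W \<in> measurable M S"
    and f: "\<And>y. y \<in> \<Y> \<Longrightarrow> \<exists>f. information_space.finite_entropy (cond_space M Y y) b S W f"
  shows "prob_space.entropy M b (S \<Otimes>\<^sub>M count_space \<Y>) (\<lambda>\<omega>. (W \<omega>, Y \<omega>))
    = prob_space.entropy M b (count_space \<Y>) Y
      + (\<Sum>y\<in>\<Y>. measure M (Y -` {y} \<inter> space M) * prob_space.entropy (cond_space M Y y) b S W)"
proof -
  interpret information_space M b by fact
  interpret S: sigma_finite_measure S by fact
  interpret C: sigma_finite_measure "count_space \<Y>"
    using fin by (rule sigma_finite_measure_count_space_finite)
  interpret P: pair_sigma_finite S "count_space \<Y>" ..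
  let ?p = "\<lambda>y. measure M (Y -` {y} \<inter> space M)"
  obtain f where f: "\<And>y. y \<in> \<Y> \<Longrightarrow> information_space.finite_entropy (cond_space M Y y) b S W (f y)"
    using f by metis
  have I: "information_space (cond_space M Y y) b" if "y \<in> \<Y>" for y
    by (rule information_space_cond_space[OF inf Y p[OF that]])
  have D: "distributed (cond_space M Y y) S W (f y)"
    and int: "integrable S (\<lambda>x. f y x * log b (f y x))"
    and nn: "x \<in> space S \<Longrightarrow> 0 \<le> f y x" if "y \<in> \<Y>" for y x
    using f[OF that] unfolding information_space.finite_entropy_def[OF I[OF that]] by auto
  have fm: "f y \<in> borel_measurable S" if "y \<in> \<Y>" for y
    using information_space.finite_entropy_measurable[OF I f] that by blast
  have If: "integrable S (f y)" "integral\<^sup>L S (f y) = 1" if "y \<in> \<Y>" for y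
  proof -
    interpret c: information_space "cond_space M Y y" b by (rule I[OF that])
    note distributed_integrable[OF D[OF that], of "\<lambda>_. 1"] distributed_integral[OF D[OF that], of "\<lambda>_. 1"]
    then show "integrable S (f y)" "integral\<^sup>L S (f y) = 1"
      using nn[OF that] c.prob_space by (simp_all add: c.prob_space)
  qed
  let ?g = "\<lambda>(x, y). ?p y * f y x"
  have "distributed M (S \<Otimes>\<^sub>M count_space \<Y>) (\<lambda>\<omega>. (W \<omega>, Y \<omega>))
    (\<lambda>(x, y). ennreal (?p y) * ennreal (f y x))"
    using D by (intro distributed_mixed[OF inf S Y fin p W])
  then have DM: "distributed M (S \<Otimes>\<^sub>M count_space \<Y>) (\<lambda>\<omega>. (W \<omega>, Y \<omega>)) ?g"
    by (simp add: ennreal_mult' split_beta')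
  have gnn: "0 \<le> ?g z" if "z \<in> space (S \<Otimes>\<^sub>M count_space \<Y>)" for z
    using that nn by (auto simp: space_pair_measure)
  have [measurable]: "?g \<in> borel_measurable (S \<Otimes>\<^sub>M count_space \<Y>)"
    by (rule distributed_real_measurable[OF gnn DM])
  let ?h = "\<lambda>z. ?g z * log b (?g z)"
  have [measurable]: "?h \<in> borel_measurable (S \<Otimes>\<^sub>M count_space \<Y>)" by measurable
  \<comment> \<open>The product rule for the logarithm needs \<open>f y x\<close> to be positive;
    where it is 0, both sides are 0.\<close>
  have heq: "?h (x, y) = ?p y * log b (?p y) * f y x + ?p y * (f y x * log b (f y x))"
    if "y \<in> \<Y>" "x \<in> space S" for x y
    using p[OF that(1)] nn[OF that] b_gt_1
    by (cases "f y x = 0") (auto simp: log_mult algebra_simps)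
  have hint: "has_bochner_integral S (\<lambda>x. ?h (x, y))
      (?p y * log b (?p y) + ?p y * (\<integral>x. f y x * log b (f y x) \<partial>S))" if y: "y \<in> \<Y>" for y
  proof -
    have "has_bochner_integral S (\<lambda>x. ?p y * log b (?p y) * f y x + ?p y * (f y x * log b (f y x)))
      (?p y * log b (?p y) * 1 + ?p y * (\<integral>x. f y x * log b (f y x) \<partial>S))"
      using If[OF y] int[OF y]
      by (intro has_bochner_integral_add has_bochner_integral_mult_right) (auto simp: has_bochner_integral_iff)
    then show ?thesis
      using heq[OF y] by (subst has_bochner_integral_cong[OF refl _ refl]) auto
  qed
  \<comment> \<open>With the finite counting measure as outer factor, Fubini's criterion only asks
    for integrability of every slice; hence the swap of the factors.\<close>
  have hint': "integrable (S \<Otimes>\<^sub>M count_space \<Y>) ?h"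
  proof -
    have "integrable (count_space \<Y> \<Otimes>\<^sub>M S) (\<lambda>(y, x). ?h (x, y))"
    proof (rule pair_sigma_finite.Fubini_integrable)
      show "pair_sigma_finite (count_space \<Y>) S" ..
      show "AE y in count_space \<Y>. integrable S (\<lambda>x. (\<lambda>(y, x). ?h (x, y)) (y, x))"
        using hint by (auto simp: AE_count_space has_bochner_integral_iff)
    qed (use fin in \<open>auto intro!: integrable_count_space\<close>)
    then show ?thesis
      by (subst P.integrable_product_swap_iff[symmetric]) (simp add: split_beta')
  qed
  have "entropy b (S \<Otimes>\<^sub>M count_space \<Y>) (\<lambda>\<omega>. (W \<omega>, Y \<omega>)) = - integral\<^sup>L (S \<Otimes>\<^sub>M count_space \<Y>) ?h"
    by (rule entropy_distr[OF DM gnn])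
  also have "integral\<^sup>L (S \<Otimes>\<^sub>M count_space \<Y>) ?h = (\<integral>y. (\<integral>x. ?h (x, y) \<partial>S) \<partial>count_space \<Y>)"
    using P.integral_snd[of "\<lambda>x y. ?h (x, y)"] hint' by (simp add: split_beta')
  also have "\<dots> = (\<Sum>y\<in>\<Y>. ?p y * log b (?p y) + ?p y * (\<integral>x. f y x * log b (f y x) \<partial>S))"
    using fin has_bochner_integral_integral_eq[OF hint] by (simp add: lebesgue_integral_count_space_finite)
  also have "- \<dots> = - (\<Sum>y\<in>\<Y>. ?p y * log b (?p y)) + (\<Sum>y\<in>\<Y>. ?p y * (- (\<integral>x. f y x * log b (f y x) \<partial>S)))"
    by (simp add: sum.distrib sum_negf)
  also have "- (\<Sum>y\<in>\<Y>. ?p y * log b (?p y)) = entropy b (count_space \<Y>) Y"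
    using fin by (subst entropy_distr[OF distributed_discrete[OF prob_space_axioms Y fin]])
      (auto simp: lebesgue_integral_count_space_finite)
  also have "(\<Sum>y\<in>\<Y>. ?p y * (- (\<integral>x. f y x * log b (f y x) \<partial>S)))
    = (\<Sum>y\<in>\<Y>. ?p y * prob_space.entropy (cond_space M Y y) b S W)"
    using information_space.entropy_distr[OF I D nn] by (intro sum.cong) auto
  finally show ?thesis .
qed

text \<open>Entropy is minus the divergence of the law from the reference measure. A relabelling
  \<open>T\<close> of the values that is invertible and carries one reference measure to the other
  therefore preserves it.\<close>

lemma entropy_distr_eq:
  assumes M: "prob_space M" and S: "sigma_finite_measure S" and S': "sigma_finite_measure S'"
    and T: "T \<in> measurable S S'" and T': "T' \<in> measurable S' S"
    and inv: "\<And>x. x \<in> space S \<Longrightarrow> T' (T x) = x" and D: "distr S S' T = S'"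
    and W: "distributed M S W f"
  shows "prob_space.entropy M b S' (\<lambda>\<omega>. T (W \<omega>)) = prob_space.entropy M b S W"
proof -
  interpret prob_space M by fact
  have mW: "W \<in> measurable M S" using W by (simp add: distributed_def)
  have ac: "absolutely_continuous S (distr M S W)"
    unfolding distributed_distr_eq_density[OF W]
    using W by (intro absolutely_continuousI_density) (simp add: distributed_def)
  have "sigma_finite_measure (distr S S' T)" using S' D by simp
  from KL_divergence_distr(2)[OF S this T T' _ ac, of b] inv
  have "KL_divergence b S' (distr (distr M S W) S' T) = KL_divergence b S (distr M S W)"
    by (simp add: D)
  then show ?thesis
    using T mW by (simp add: entropy_def distr_distr comp_def)
qed

text \<open>\<open>mixed_entropy\<close> refers to functions on an index set, the conditional
  entropies to reals or pairs of reals. \<open>T\<close> translates between the two encodings and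
  leaves the value of \<open>Y\<close> alone, so the chain rule \<open>entropy_mixed\<close> carries
  over.\<close>

lemma mixed_entropy_transport:
  assumes inf: "information_space M b" and S: "sigma_finite_measure S" and S': "sigma_finite_measure S'"
    and Y[measurable]: "Y \<in> measurable M (count_space \<Y>)" and fin: "finite \<Y>"
    and p: "\<And>y. y \<in> \<Y> \<Longrightarrow> 0 < measure M (Y -` {y} \<inter> space M)"
    and W[measurable]: "W \<in> measurable M S"
    and f: "\<And>y. y \<in> \<Y> \<Longrightarrow> \<exists>f. information_space.finite_entropy (cond_space M Y y) b S W f"
    and T[measurable]: "T \<in> measurable S S'" and T'[measurable]: "T' \<in> measurable S' S"
    and inv: "\<And>x. x \<in> space S \<Longrightarrow> T' (T x) = x" and D: "distr S S' T = S'"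
  shows "prob_space.entropy M b (S' \<Otimes>\<^sub>M count_space \<Y>) (\<lambda>\<omega>. (T (W \<omega>), Y \<omega>))
    = prob_space.entropy M b (count_space \<Y>) Y
      + (\<Sum>y\<in>\<Y>. measure M (Y -` {y} \<inter> space M) * prob_space.entropy (cond_space M Y y) b S W)"
proof -
  interpret information_space M b by fact
  interpret S: sigma_finite_measure S by fact
  interpret S': sigma_finite_measure S' by fact
  interpret C: sigma_finite_measure "count_space \<Y>"
    using fin by (rule sigma_finite_measure_count_space_finite)
  interpret P: pair_sigma_finite S "count_space \<Y>" ..
  interpret P': pair_sigma_finite S' "count_space \<Y>" ..
  obtain f where f': "\<And>y. y \<in> \<Y> \<Longrightarrow> information_space.finite_entropy (cond_space M Y y) b S W (f y)"
    using f by metis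
  have "distributed (cond_space M Y y) S W (f y)" if "y \<in> \<Y>" for y
    using information_space.finite_entropy_distributed[OF information_space_cond_space[OF inf Y p] f'] that
    by blast
  from distributed_mixed[OF inf S Y fin p W this]
  have d: "distributed M (S \<Otimes>\<^sub>M count_space \<Y>) (\<lambda>\<omega>. (W \<omega>, Y \<omega>))
    (\<lambda>(x, y). ennreal (measure M (Y -` {y} \<inter> space M)) * ennreal (f y x))" .
  have D': "distr (S \<Otimes>\<^sub>M count_space \<Y>) (S' \<Otimes>\<^sub>M count_space \<Y>) (\<lambda>(x, y). (T x, y)) = S' \<Otimes>\<^sub>M count_space \<Y>"
    using pair_measure_distr[OF T measurable_ident, of "count_space \<Y>"] C.sigma_finite_measure_axioms
    by (simp add: D id_def distr_id)
  have "entropy b (S' \<Otimes>\<^sub>M count_space \<Y>) (\<lambda>\<omega>. (\<lambda>(x, y). (T x, y)) (W \<omega>, Y \<omega>))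
    = entropy b (S \<Otimes>\<^sub>M count_space \<Y>) (\<lambda>\<omega>. (W \<omega>, Y \<omega>))"
  proof (rule entropy_distr_eq[OF prob_space_axioms P.sigma_finite_measure_axioms
        P'.sigma_finite_measure_axioms _ _ _ D' d])
    show "(\<lambda>(x, y). (T' x, y)) \<in> measurable (S' \<Otimes>\<^sub>M count_space \<Y>) (S \<Otimes>\<^sub>M count_space \<Y>)"
      by measurable
  qed (use inv in \<open>auto simp: space_pair_measure\<close>)
  then show ?thesis
    using entropy_mixed[OF inf S Y fin p W f] by simp
qed

section \<open>Lebesgue measure on index sets with one or two elements\<close>

lemma distr_lborel_PiM_singleton:
  "distr lborel (\<Pi>\<^sub>M k\<in>{i}. lborel :: real measure) (\<lambda>x. \<lambda>k\<in>{i}. x) = (\<Pi>\<^sub>M k\<in>{i}. lborel)"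
proof -
  interpret product_sigma_finite "\<lambda>_ :: 'a. lborel :: real measure" ..
  show ?thesis by (rule distr_component)
qed

text \<open>A product measure is determined by its values on boxes, and the preimage of a box is the
  rectangle \<open>A i \<times> A j\<close>.\<close>

lemma distr_lborel_PiM_pair:
  assumes "i \<noteq> j"
  shows "distr (lborel \<Otimes>\<^sub>M lborel) (\<Pi>\<^sub>M k\<in>{i, j}. lborel :: real measure)
    (\<lambda>z. \<lambda>k\<in>{i, j}. if k = i then fst z else snd z) = (\<Pi>\<^sub>M k\<in>{i, j}. lborel)" (is "distr ?L ?P ?T = _")
proof -
  interpret product_sigma_finite "\<lambda>_ :: 'a. lborel :: real measure" ..
  have T: "?T \<in> measurable ?L ?P"
    by (intro measurable_restrict) auto
  show ?thesis
  proof (rule PiM_eqI)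
    fix A :: "'a \<Rightarrow> real set" assume A: "\<And>k. k \<in> {i, j} \<Longrightarrow> A k \<in> sets lborel"
    have "?T -` Pi\<^sub>E {i, j} A \<inter> space ?L = A i \<times> A j"
      using assms by (auto simp: space_pair_measure PiE_iff)
    then show "emeasure (distr ?L ?P ?T) (Pi\<^sub>E {i, j} A) = (\<Prod>k\<in>{i, j}. emeasure lborel (A k))"
      using A assms T
      by (subst emeasure_distr) (auto intro!: sets_PiM_I_finite simp: lborel.emeasure_pair_measure_Times)
  qed simp_all
qed

text \<open>\<open>mixed_info\<close> adds the entropy of \<open>Y\<close>, and the chain rule makes
  the joint entropy contain it too, so it cancels.\<close>

lemma mixed_info_singleton:
  assumes inf: "information_space M b"
    and Y[measurable]: "Y \<in> measurable M (count_space \<Y>)" and fin: "finite \<Y>"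
    and p: "\<And>y. y \<in> \<Y> \<Longrightarrow> 0 < measure M (Y -` {y} \<inter> space M)"
    and X[measurable]: "X i \<in> borel_measurable M"
    and f: "\<And>y. y \<in> \<Y> \<Longrightarrow> \<exists>f. information_space.finite_entropy (cond_space M Y y) b lborel (X i) f"
  shows "mixed_info M b X \<Y> Y {i} = prob_space.entropy M b lborel (X i)
    - (\<Sum>y\<in>\<Y>. measure M (Y -` {y} \<inter> space M) * prob_space.entropy (cond_space M Y y) b lborel (X i))"
proof -
  interpret product_sigma_finite "\<lambda>_ :: nat. lborel :: real measure" ..
  interpret F: finite_product_sigma_finite "\<lambda>_ :: nat. lborel :: real measure" "{i}"
    by standard simp
  \<comment> \<open>This exhibits the restricted family as the image of \<open>X i\<close> under the
    map of \<open>distr_lborel_PiM_singleton\<close>.\<close>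
  have eq: "(\<lambda>\<omega>. (\<lambda>k\<in>{i}. X k \<omega>, Y \<omega>)) = (\<lambda>\<omega>. (\<lambda>k\<in>{i}. X i \<omega>, Y \<omega>))"
    by (auto simp: fun_eq_iff)
  have "mixed_entropy M b X \<Y> Y {i} = prob_space.entropy M b (count_space \<Y>) Y
      + (\<Sum>y\<in>\<Y>. measure M (Y -` {y} \<inter> space M) * prob_space.entropy (cond_space M Y y) b lborel (X i))"
    unfolding mixed_entropy_def eq
  proof (rule mixed_entropy_transport[OF inf _ F.sigma_finite_measure_axioms Y fin p _ f _ _ _ distr_lborel_PiM_singleton])
    show "(\<lambda>x. x i) \<in> measurable (\<Pi>\<^sub>M k\<in>{i}. lborel) (lborel :: real measure)"
      by (rule measurable_component_singleton) simp
  qed (auto intro: lborel.sigma_finite_measure_axioms measurable_restrict)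
  then show ?thesis by (simp add: mixed_info_def)
qed

text \<open>The entropy of \<open>Y\<close> cancels as for a single index. Distinctness of
  \<open>i\<close> and \<open>j\<close> keeps the index set two-dimensional.\<close>

lemma mixed_info_pair:
  assumes inf: "information_space M b"
    and Y[measurable]: "Y \<in> measurable M (count_space \<Y>)" and fin: "finite \<Y>"
    and p: "\<And>y. y \<in> \<Y> \<Longrightarrow> 0 < measure M (Y -` {y} \<inter> space M)"
    and X[measurable]: "X i \<in> borel_measurable M" "X j \<in> borel_measurable M" and ij: "i \<noteq> j"
    and f: "\<And>y. y \<in> \<Y> \<Longrightarrow> \<exists>f. information_space.finite_entropy (cond_space M Y y) b
      (lborel \<Otimes>\<^sub>M lborel) (\<lambda>\<omega>. (X i \<omega>, X j \<omega>)) f"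
  shows "mixed_info M b X \<Y> Y {i, j}
    = prob_space.entropy M b lborel (X i) + prob_space.entropy M b lborel (X j)
    - (\<Sum>y\<in>\<Y>. measure M (Y -` {y} \<inter> space M) *
        prob_space.entropy (cond_space M Y y) b (lborel \<Otimes>\<^sub>M lborel) (\<lambda>\<omega>. (X i \<omega>, X j \<omega>)))"
proof -
  interpret product_sigma_finite "\<lambda>_ :: nat. lborel :: real measure" ..
  interpret F: finite_product_sigma_finite "\<lambda>_ :: nat. lborel :: real measure" "{i, j}"
    by standard simp
  have L: "sigma_finite_measure (lborel \<Otimes>\<^sub>M lborel :: (real \<times> real) measure)"
    unfolding lborel_prod by (rule lborel.sigma_finite_measure_axioms)
  \<comment> \<open>The family over \<open>{i, j}\<close> becomes the image of the pair
    \<open>(X i, X j)\<close> under the map of \<open>distr_lborel_PiM_pair\<close>.\<close>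
  have eq: "(\<lambda>\<omega>. (\<lambda>k\<in>{i, j}. X k \<omega>, Y \<omega>))
      = (\<lambda>\<omega>. (\<lambda>k\<in>{i, j}. if k = i then fst (X i \<omega>, X j \<omega>) else snd (X i \<omega>, X j \<omega>), Y \<omega>))"
    by (auto simp: fun_eq_iff)
  have "mixed_entropy M b X \<Y> Y {i, j} = prob_space.entropy M b (count_space \<Y>) Y
      + (\<Sum>y\<in>\<Y>. measure M (Y -` {y} \<inter> space M) *
        prob_space.entropy (cond_space M Y y) b (lborel \<Otimes>\<^sub>M lborel) (\<lambda>\<omega>. (X i \<omega>, X j \<omega>)))"
    unfolding mixed_entropy_def eq
  proof (rule mixed_entropy_transport[OF inf L F.sigma_finite_measure_axioms Y fin p _ f _ _ _ distr_lborel_PiM_pair[OF ij]])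
    show "(\<lambda>x. (x i, x j)) \<in> measurable (\<Pi>\<^sub>M k\<in>{i, j}. lborel) (lborel \<Otimes>\<^sub>M lborel :: (real \<times> real) measure)"
      by (intro measurable_Pair measurable_component_singleton) simp_all
  qed (use ij in \<open>auto intro!: measurable_restrict\<close>)
  then show ?thesis using ij by (simp add: mixed_info_def)
qed

section \<open>Sums over the junction tree\<close>

text \<open>Every vertex after the first is the child in its own cluster. The first one has no such
  cluster, but it is the mother of the second.\<close>

lemma gnb_build_covered:
  assumes "gnb_build D \<mu> vs E" "s \<in> set vs"
  shows "\<exists>i\<in>set (tl vs). s \<in> {i, \<mu> i}"
  using assms
proof induction
  case (add_vertex vs E j)
  then have "vs \<noteq> []" by auto
  then have "set (tl (vs @ [j])) = insert j (set (tl vs))" by (cases vs) auto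
  then show ?case using add_vertex by auto
qed auto

lemma gnb_mother:
  assumes "gnb_graph d \<mu> vs E" "i \<in> set (tl vs)"
  shows "i \<in> {1..d}" "\<mu> i \<in> {1..d}" "\<mu> i \<noteq> i"
proof -
  have b: "gnb_build {1..d} \<mu> vs E" and D: "set vs = {1..d}"
    using assms by (auto simp: gnb_graph_def)
  note P = gnb_build_props[OF b]
  show "i \<in> {1..d}" using assms(2) D by (cases vs) auto
  show "\<mu> i \<in> {1..d}" "\<mu> i \<noteq> i" using P D assms(2) by auto
qed

text \<open>
  A pair \<open>{0, s}\<close> in a single cluster is not a separator, but its summand would be \<open>0\<close>. So the
  separator sum may run over all of \<open>D\<close>, once every \<open>s\<close> is known to lie in at least one cluster.
\<close>

lemma junction_tree_sum:
  fixes J :: "nat set \<Rightarrow> real"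
  assumes G: "gnb_graph d \<mu> vs E"
  shows "(\<Sum>C\<in>clusters d E. J (C - {0}))
      - (\<Sum>S\<in>separators d E. (real (multiplicity_of d E S) - 1) * J (S - {0}))
    = (\<Sum>s=1..d. J {s}) + (\<Sum>i\<in>set (tl vs). J {i, \<mu> i} - J {i} - J {\<mu> i})"
proof -
  let ?T = "set (tl vs)"
  let ?m = "\<lambda>s. multiplicity_of d E {0, s}"
  note cl = gnb_clusters[OF G] and mo = gnb_mother[OF G]
  have b: "gnb_build {1..d} \<mu> vs E" and D: "set vs = {1..d}"
    using G by (auto simp: gnb_graph_def)
  have mult: "?m s = card {i\<in>?T. s \<in> {i, \<mu> i}}" if s: "s \<in> {1..d}" for s
  proof -
    \<comment> \<open>Clusters correspond to their children \<open>i\<close>, so the multiplicity of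
      \<open>{0, s}\<close> counts the \<open>i\<close> for which \<open>s\<close> is the child or
      the mother.\<close>
    have "{C \<in> clusters d E. {0, s} \<subseteq> C} = (\<lambda>i. {0, i, \<mu> i}) ` {i\<in>?T. s \<in> {i, \<mu> i}}"
      unfolding cl(1) using s by auto
    moreover have "inj_on (\<lambda>i. {0, i, \<mu> i}) {i\<in>?T. s \<in> {i, \<mu> i}}"
      using cl(2) by (rule inj_on_subset) auto
    ultimately show ?thesis
      unfolding multiplicity_of_def by (simp only: card_image)
  qed
  have pos: "1 \<le> ?m s" if "s \<in> {1..d}" for s
  proof -
    have "{i\<in>?T. s \<in> {i, \<mu> i}} \<noteq> {}" using gnb_build_covered[OF b, of s] that D by auto
    then have "0 < card {i\<in>?T. s \<in> {i, \<mu> i}}" by (subst card_gt_0_iff) simp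
    then show ?thesis using mult[OF that] by linarith
  qed
  have "(\<Sum>C\<in>clusters d E. J (C - {0})) = (\<Sum>i\<in>?T. J ({0, i, \<mu> i} - {0}))"
    unfolding cl(1) by (simp add: sum.reindex[OF cl(2)])
  also have "\<dots> = (\<Sum>i\<in>?T. J {i, \<mu> i})"
  proof (rule sum.cong[OF refl])
    fix i assume "i \<in> ?T"
    then have "{0, i, \<mu> i} - {0} = {i, \<mu> i}" using mo[of i] by auto
    then show "J ({0, i, \<mu> i} - {0}) = J {i, \<mu> i}" by simp
  qed
  finally have 1: "(\<Sum>C\<in>clusters d E. J (C - {0})) = (\<Sum>i\<in>?T. J {i, \<mu> i})" .
  have sep: "separators d E = (\<lambda>s. {0, s}) ` {s\<in>{1..d}. 2 \<le> ?m s}"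
    by (auto simp: separators_def)
  have inj: "inj_on (\<lambda>s :: nat. {0, s}) {s\<in>{1..d}. 2 \<le> ?m s}"
    by (auto simp: inj_on_def doubleton_eq_iff)
  have "(\<Sum>S\<in>separators d E. (real (multiplicity_of d E S) - 1) * J (S - {0}))
    = (\<Sum>s\<in>{s\<in>{1..d}. 2 \<le> ?m s}. (real (?m s) - 1) * J ({0, s} - {0}))"
    unfolding sep by (subst sum.reindex[OF inj]) (simp only: o_def)
  also have "\<dots> = (\<Sum>s\<in>{s\<in>{1..d}. 2 \<le> ?m s}. (real (?m s) - 1) * J {s})"
    by (intro sum.cong refl arg_cong2[where f="(*)"] arg_cong[where f=J]) auto
  also have "\<dots> = (\<Sum>s=1..d. (real (?m s) - 1) * J {s})"
  proof (rule sum.mono_neutral_left)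
    show "\<forall>s\<in>{1..d} - {s\<in>{1..d}. 2 \<le> ?m s}. (real (?m s) - 1) * J {s} = 0"
    proof
      fix s assume s: "s \<in> {1..d} - {s\<in>{1..d}. 2 \<le> ?m s}"
      then have "?m s = 1" using pos[of s] by auto
      then show "(real (?m s) - 1) * J {s} = 0" by simp
    qed
  qed auto
  finally have 2: "(\<Sum>S\<in>separators d E. (real (multiplicity_of d E S) - 1) * J (S - {0}))
    = (\<Sum>s=1..d. real (?m s) * J {s}) - (\<Sum>s=1..d. J {s})"
    by (simp add: left_diff_distrib sum_subtractf)
  \<comment> \<open>Double counting of the incidences between vertices and clusters: each cluster
    meets its two vertices of \<open>D\<close>, and each vertex \<open>s\<close> is met
    \<open>?m s\<close> times.\<close>
  have "(\<Sum>i\<in>?T. J {i} + J {\<mu> i}) = (\<Sum>i\<in>?T. \<Sum>s\<in>{s\<in>{1..d}. s \<in> {i, \<mu> i}}. J {s})"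
  proof (rule sum.cong[OF refl])
    fix i assume i: "i \<in> ?T"
    then have "{s\<in>{1..d}. s \<in> {i, \<mu> i}} = {i, \<mu> i}" using mo[of i] by auto
    then show "J {i} + J {\<mu> i} = (\<Sum>s\<in>{s\<in>{1..d}. s \<in> {i, \<mu> i}}. J {s})"
      using mo(3)[OF i] by simp
  qed
  also have "\<dots> = (\<Sum>s\<in>{1..d}. \<Sum>i\<in>{i\<in>?T. s \<in> {i, \<mu> i}}. J {s})"
    by (rule sum.swap_restrict) auto
  also have "\<dots> = (\<Sum>s=1..d. real (?m s) * J {s})"
    by (intro sum.cong refl) (simp only: mult sum_constant)
  finally have 3: "(\<Sum>i\<in>?T. J {i} + J {\<mu> i}) = (\<Sum>s=1..d. real (?m s) * J {s})" .
  show ?thesis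
    unfolding 1 2 3[symmetric] by (simp add: sum.distrib sum_subtractf)
qed

text \<open>By \<open>gnb_clusters\<close>, the clusters are in bijection with the children in
  \<open>set (tl vs)\<close>, over which the last sum runs. \<open>finite_entropy\<close> combines
  the existence of a density with the finiteness of the entropy.\<close>

theorem theorem11:
  fixes M :: "'a measure" and b :: real and d :: nat
    and X :: "nat \<Rightarrow> 'a \<Rightarrow> real" and Y :: "'a \<Rightarrow> 'y" and \<Y> :: "'y set"
    and \<mu> :: "nat \<Rightarrow> nat" and vs :: "nat list" and E :: "nat set set"
  assumes "information_space M b"
    and "2 \<le> d"
    and "finite \<Y>"
    and "Y \<in> measurable M (count_space \<Y>)"
    and "\<And>y. y \<in> \<Y> \<Longrightarrow> 0 < measure M (Y -` {y} \<inter> space M)"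
    and "gnb_graph d \<mu> vs E"
    and "\<And>i. i \<in> {1..d} \<Longrightarrow> \<exists>f. information_space.finite_entropy M b lborel (X i) f"
    and "\<And>i y. i \<in> {1..d} \<Longrightarrow> y \<in> \<Y> \<Longrightarrow>
      \<exists>f. information_space.finite_entropy (cond_space M Y y) b lborel (X i) f"
    and "\<And>i y. i \<in> set (tl vs) \<Longrightarrow> y \<in> \<Y> \<Longrightarrow>
      \<exists>f. information_space.finite_entropy (cond_space M Y y) b (lborel \<Otimes>\<^sub>M lborel)
        (\<lambda>\<omega>. (X i \<omega>, X (\<mu> i) \<omega>)) f"
  shows "gnb_weight M b X \<Y> Y d E =
    (\<Sum>i=1..d. prob_space.entropy M b lborel (X i))
    - (\<Sum>y\<in>\<Y>. measure M (Y -` {y} \<inter> space M) *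
        (\<Sum>i=1..d. prob_space.entropy (cond_space M Y y) b lborel (X i)))
    + (\<Sum>i\<in>set (tl vs). \<Sum>y\<in>\<Y>. measure M (Y -` {y} \<inter> space M) *
        copula_info b (copula_density (cond_space M Y y) (X i) (X (\<mu> i))))"
proof -
  note inf = assms(1) and fin = assms(3) and Y = assms(4) and p = assms(5) and G = assms(6)
  let ?p = "\<lambda>y. measure M (Y -` {y} \<inter> space M)"
  let ?H = "\<lambda>i. prob_space.entropy M b lborel (X i)"
  let ?Hy = "\<lambda>i y. prob_space.entropy (cond_space M Y y) b lborel (X i)"
  let ?Hyy = "\<lambda>i y. prob_space.entropy (cond_space M Y y) b (lborel \<Otimes>\<^sub>M lborel) (\<lambda>\<omega>. (X i \<omega>, X (\<mu> i) \<omega>))"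
  let ?c = "\<lambda>i y. copula_info b (copula_density (cond_space M Y y) (X i) (X (\<mu> i)))"
  let ?J = "mixed_info M b X \<Y> Y"
  have X: "X i \<in> borel_measurable M" if i: "i \<in> {1..d}" for i
  proof -
    obtain f where "information_space.finite_entropy M b lborel (X i) f"
      using assms(7)[OF i] by blast
    from information_space.finite_entropy_distributed[OF inf this]
    show ?thesis by (simp add: distributed_def)
  qed
  have one: "?J {i} = ?H i - (\<Sum>y\<in>\<Y>. ?p y * ?Hy i y)" if "i \<in> {1..d}" for i
    using that by (intro mixed_info_singleton[OF inf Y fin p] X assms(8))
  \<comment> \<open>The copula lemma is applied inside the conditional probability space given
    \<open>y\<close>, so the distribution functions are the conditional ones.\<close>
  have copula: "?c i y = ?Hy i y + ?Hy (\<mu> i) y - ?Hyy i y" if i: "i \<in> set (tl vs)" and y: "y \<in> \<Y>" for i y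
  proof -
    note m = gnb_mother[OF G i]
    obtain f g h where
      "information_space.finite_entropy (cond_space M Y y) b lborel (X i) f"
      "information_space.finite_entropy (cond_space M Y y) b lborel (X (\<mu> i)) g"
      "information_space.finite_entropy (cond_space M Y y) b (lborel \<Otimes>\<^sub>M lborel) (\<lambda>\<omega>. (X i \<omega>, X (\<mu> i) \<omega>)) h"
      using assms(8)[OF m(1) y] assms(8)[OF m(2) y] assms(9)[OF i y] by blast
    from copula_info_eq_pair_info[OF information_space_cond_space[OF inf Y p[OF y]] this]
    show ?thesis by (simp add: pair_info_def)
  qed
  \<comment> \<open>The unconditional entropies of \<open>X i\<close> and \<open>X (\<mu> i)\<close>
    cancel; what remains is the average over \<open>y\<close> of the conditional mutual
    information.\<close>
  have two: "?J {i, \<mu> i} - ?J {i} - ?J {\<mu> i} = (\<Sum>y\<in>\<Y>. ?p y * ?c i y)" if i: "i \<in> set (tl vs)" for i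
  proof -
    note m = gnb_mother[OF G i]
    have "?J {i, \<mu> i} = ?H i + ?H (\<mu> i) - (\<Sum>y\<in>\<Y>. ?p y * ?Hyy i y)"
      using m(3) by (intro mixed_info_pair[OF inf Y fin p X X] m assms(9) i) auto
    then have "?J {i, \<mu> i} - ?J {i} - ?J {\<mu> i} = (\<Sum>y\<in>\<Y>. ?p y * (?Hy i y + ?Hy (\<mu> i) y - ?Hyy i y))"
      by (simp add: one[OF m(1)] one[OF m(2)] algebra_simps sum.distrib sum_subtractf)
    also have "\<dots> = (\<Sum>y\<in>\<Y>. ?p y * ?c i y)"
      using i by (intro sum.cong refl) (simp add: copula)
    finally show ?thesis .
  qed
  have "gnb_weight M b X \<Y> Y d E
      = (\<Sum>i=1..d. ?J {i}) + (\<Sum>i\<in>set (tl vs). ?J {i, \<mu> i} - ?J {i} - ?J {\<mu> i})"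
    unfolding gnb_weight_def by (rule junction_tree_sum[OF G])
  also have "(\<Sum>i=1..d. ?J {i}) = (\<Sum>i=1..d. ?H i) - (\<Sum>i=1..d. \<Sum>y\<in>\<Y>. ?p y * ?Hy i y)"
    by (simp add: one sum_subtractf)
  also have "(\<Sum>i=1..d. \<Sum>y\<in>\<Y>. ?p y * ?Hy i y) = (\<Sum>y\<in>\<Y>. ?p y * (\<Sum>i=1..d. ?Hy i y))"
    by (subst sum.swap) (simp add: sum_distrib_left)
  also have "(\<Sum>i\<in>set (tl vs). ?J {i, \<mu> i} - ?J {i} - ?J {\<mu> i}) = (\<Sum>i\<in>set (tl vs). \<Sum>y\<in>\<Y>. ?p y * ?c i y)"
    by (intro sum.cong refl two)
  finally show ?thesis .
qed

end
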